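(* Let $a<b$ be real and let $z:[a,b]\to\mathbb{C}$ be either an algebraic polynomial of degree $k\ge 1$ with complex coefficients, or a trigonometric polynomial of degree $k\geq 1$ with complex coefficients, where in the trigonometric case $b-a\le 2\pi$. Let $\Gamma=z([a,b])\subset\mathbb{C}$. For $n\ge 1$ and $m>1$ let $Z_n^m(k)=z(X_{nk}^m)$, where $X_{nk}^m\subset[a,b]$ is the set of mapped Chebyshev points defined in the context with $\nu=nk$ (algebraic or trigonometric version according to the type of $z$; $m$ is such that the number $N$ there is an integer). Then for every $n\ge 1$, every $m>1$ and every $p\in\mathbb{P}_n(\mathbb{C})$, $$\|p\|_\Gamma\le c_m\,\|p\|_{Z_n^m(k)},\qquad c_m=\frac{1}{\cos(\pi/(2m))}.$$ Consequently, for fixed $m>1$ (such that $N$ is an integer for all $n\geq 1$), the sequence $(Z_n^m(k))_{n\ge1}$ is an optimal admissible polynomial mesh for $\Gamma$.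
   Context: $\mathbb{P}_n(\mathbb{C})$ is the space of polynomials in one complex variable with complex coefficients of degree at most $n$. For a compact set $Y$ (continuous or discrete), $\|\cdot\|_Y$ is the sup-norm on $Y$. A trigonometric polynomial of degree at most $\nu$ with complex coefficients is a complex linear combination of $1,\cos(jt),\sin(jt)$, $1\le j\le\nu$. Chebyshev points: for a positive integer $N$, $\mathcal{T}_N$ denotes either the set of $N$ Chebyshev zeros $\cos((2j-1)\pi/(2N))$, $1\le j\le N$, or the set of $N+1$ Chebyshev extrema $\cos(j\pi/N)$, $0\le j\le N$ (the result holds for either choice). Mapped points: $X_\nu^m=\sigma(\mathcal{T}_N)\subset[a,b]$, where - in the algebraic case $N=m\nu$ and $\sigma(u)=\frac{b-a}{2}u+\frac{b+a}{2}$, $u\in[-1,1]$; - in the trigonometric case $N=2m\nu$ and $\sigma(u)=2\arcsin\left(u\sin\left(\frac{b-a}{4}\right)\right)+\frac{b+a}{2}$, $u\in[-1,1]$. Admissible polynomial mesh: let $K\subset\mathbb{C}$ be compact and polynomially determining (a polynomial vanishing on $K$ vanishes identically on $\mathbb{C}$). A sequence of finite subsets $Z_n\subset K$ is an admissible polynomial mesh for $K$ if there is a constant $c$ independent of $n$ with $\|p\|_K\le c\|p\|_{Z_n}$ for all $p\in\mathbb{P}_n(\mathbb{C})$, and $\mathrm{card}(Z_n)=O(n^\alpha)$ for some $\alpha\ge1$. It is optimal if one can take $\alpha=1$. *)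

theory Defs
  imports
    "HOL-Analysis.Analysis"
    "HOL-Computational_Algebra.Polynomial"
    "HOL-Library.Landau_Symbols"
begin

text \<open>The value is meaningful for nonempty \<open>Y\<close> on which \<open>f\<close> is bounded.\<close>

definition sup_norm :: "complex set \<Rightarrow> (complex \<Rightarrow> complex) \<Rightarrow> real" where
  "sup_norm Y f = (SUP x\<in>Y. norm (f x))"

definition trig_sum :: "(nat \<Rightarrow> complex) \<Rightarrow> (nat \<Rightarrow> complex) \<Rightarrow> nat \<Rightarrow> real \<Rightarrow> complex" where
  "trig_sum \<alpha> \<beta> k t =
     \<alpha> 0 + (\<Sum>j=1..k. \<alpha> j * of_real (cos (real j * t)) + \<beta> j * of_real (sin (real j * t)))"

datatype curve_type = Algebraic | Trigonometric

text \<open>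
  The function \<open>z\<close> is constrained on \<open>[a,b]\<close> only, and the degree is exactly \<open>k\<close>. The second
  equation is meant for \<open>k \<ge> 1\<close>: for \<open>k = 0\<close> the coefficient \<open>\<beta> 0\<close> does not occur in the sum.
\<close>

fun poly_curve :: "curve_type \<Rightarrow> nat \<Rightarrow> real \<Rightarrow> real \<Rightarrow> (real \<Rightarrow> complex) \<Rightarrow> bool" where
  "poly_curve Algebraic k a b z \<longleftrightarrow>
     (\<exists>q :: complex poly. degree q = k \<and> (\<forall>t\<in>{a..b}. z t = poly q (of_real t)))"
| "poly_curve Trigonometric k a b z \<longleftrightarrow>
     (\<exists>\<alpha> \<beta>. (\<alpha> k \<noteq> 0 \<or> \<beta> k \<noteq> 0) \<and> (\<forall>t\<in>{a..b}. z t = trig_sum \<alpha> \<beta> k t))"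

datatype chebyshev_kind = Zeros | Extrema

fun chebyshev_points :: "chebyshev_kind \<Rightarrow> nat \<Rightarrow> real set" where
  "chebyshev_points Zeros N = (\<lambda>j. cos ((2 * real j - 1) * pi / (2 * real N))) ` {1..N}"
| "chebyshev_points Extrema N = (\<lambda>j. cos (real j * pi / real N)) ` {0..N}"

fun node_map :: "curve_type \<Rightarrow> real \<Rightarrow> real \<Rightarrow> real \<Rightarrow> real" where
  "node_map Algebraic a b u = (b - a) / 2 * u + (b + a) / 2"
| "node_map Trigonometric a b u = 2 * arcsin (u * sin ((b - a) / 4)) + (b + a) / 2"

fun node_number :: "curve_type \<Rightarrow> real \<Rightarrow> nat \<Rightarrow> real" where
  "node_number Algebraic m \<nu> = m * real \<nu>"
| "node_number Trigonometric m \<nu> = 2 * m * real \<nu>"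

text \<open>
  The parameter \<open>m\<close> is real, so \<open>node_number\<close> is a real number. The definition below is meant
  for the case \<open>node_number \<tau> m \<nu> \<in> \<nat>\<close>, in which \<open>nat \<lfloor>_\<rfloor>\<close> is just a type conversion.
\<close>

definition mapped_points ::
  "curve_type \<Rightarrow> chebyshev_kind \<Rightarrow> real \<Rightarrow> real \<Rightarrow> real \<Rightarrow> nat \<Rightarrow> real set" where
  "mapped_points \<tau> \<kappa> a b m \<nu> =
     node_map \<tau> a b ` chebyshev_points \<kappa> (nat \<lfloor>node_number \<tau> m \<nu>\<rfloor>)"

definition polynomially_determining :: "complex set \<Rightarrow> bool" where
  "polynomially_determining K \<longleftrightarrow>
     (\<forall>p :: complex poly. (\<forall>x\<in>K. poly p x = 0) \<longrightarrow> (\<forall>x. poly p x = 0))"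

text \<open>
  Sequences are indexed by \<open>n \<ge> 1\<close>; the value at \<open>0\<close> is irrelevant. The condition
  \<open>Z n \<noteq> {}\<close> is implicit in the norm inequality when the sup-norm on \<open>{}\<close> is \<open>0\<close>; it
  is explicit here because \<open>Sup {}\<close> is unspecified on the reals.
\<close>

definition admissible_mesh :: "complex set \<Rightarrow> (nat \<Rightarrow> complex set) \<Rightarrow> bool" where
  "admissible_mesh K Z \<longleftrightarrow>
     compact K \<and> polynomially_determining K \<and>
     (\<forall>n\<ge>1. finite (Z n) \<and> Z n \<noteq> {} \<and> Z n \<subseteq> K) \<and>
     (\<exists>c. \<forall>n\<ge>1. \<forall>p :: complex poly. degree p \<le> n \<longrightarrow>
        sup_norm K (poly p) \<le> c * sup_norm (Z n) (poly p)) \<and>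
     (\<exists>\<alpha>\<ge>1. (\<lambda>n. real (card (Z n))) \<in> O(\<lambda>n. real n powr \<alpha>))"

definition optimal_admissible_mesh :: "complex set \<Rightarrow> (nat \<Rightarrow> complex set) \<Rightarrow> bool" where
  "optimal_admissible_mesh K Z \<longleftrightarrow>
     admissible_mesh K Z \<and> (\<lambda>n. real (card (Z n))) \<in> O(\<lambda>n. real n)"

end

theory Submission
  imports Defs
begin

text \<open>
  In the angle \<open>\<theta> = arccos u\<close> the function \<open>p (z (\<sigma> (cos \<theta>)))\<close> behaves like a trigonometric
  polynomial of degree \<open>D\<close>, where \<open>D = n k\<close> in the algebraic and \<open>D = 2 n k\<close> in the trigonometric
  case, so that \<open>N = m D\<close>. Rotate it so that its maximal modulus \<open>M\<close> is attained as a positive real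
  value at \<open>\<theta>\<^sub>0\<close> and let \<open>h\<close> be its real part. Riesz's comparison argument gives
  \<open>h (\<theta>\<^sub>0 + d) \<ge> M cos (D d)\<close> for \<open>D \<bar>d\<bar> < \<pi> / 2\<close>. Every angle is within \<open>\<pi> / (2 N)\<close> of a node, and
  \<open>D \<pi> / (2 N) = \<pi> / (2 m)\<close>.

  If the comparison failed, \<open>F \<theta> = h \<theta> - M' cos (D (\<theta> - \<phi>))\<close>, with \<open>M'\<close> slightly larger than \<open>M\<close>
  and \<open>\<phi>\<close> slightly off \<open>\<theta>\<^sub>0\<close>, would have \<open>2 D + 2\<close> zeros in a period. In the trigonometric case \<open>F\<close>
  itself is not a trigonometric polynomial, but \<open>F \<theta> F (-\<theta>)\<close> is one in the curve parameter: it is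
  \<open>h\<^sup>2 - 2 M' cos (D \<phi>) h T + M'\<^sup>2 (T\<^sup>2 - sin\<^sup>2 (D \<phi>))\<close> with \<open>T = cos (D \<theta>)\<close>, and it has at most
  \<open>2 D\<close> zeros. For a generic choice of \<open>M'\<close> and \<open>\<phi>\<close> the zeros of
  \<open>F\<close> have distinct cosines, so no multiplicities need to be counted.
\<close>

section \<open>Comparison with a cosine\<close>

text \<open>These are the Chebyshev polynomials of the first kind, built by the recurrence
  \<open>T (n + 2) = 2 x T (n + 1) - T n\<close>. The coefficients are taken complex so that they
  combine with the complex representing polynomials below.\<close>

lemma chebyshev_polynomial_exists:
  "\<exists>T :: complex poly. degree T \<le> n \<and>
     (\<forall>\<theta>. poly T (of_real (cos \<theta>)) = of_real (cos (real n * \<theta>)))"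
proof (induction n rule: induct_nat_012)
  case 0
  show ?case by (rule exI[of _ 1]) simp
next
  case 1
  show ?case by (rule exI[of _ "[:0, 1:]"]) simp
next
  case (ge2 n)
  then obtain S T :: "complex poly" where S: "degree S \<le> n"
      "\<And>\<theta>. poly S (of_real (cos \<theta>)) = of_real (cos (real n * \<theta>))"
    and T: "degree T \<le> Suc n"
      "\<And>\<theta>. poly T (of_real (cos \<theta>)) = of_real (cos (real (Suc n) * \<theta>))"
    by blast
  define V where "V = [:0, 2:] * T - S"
  have "degree V \<le> Suc (Suc n)"
    unfolding V_def using S(1) T(1)
    by (intro degree_diff_le order_trans[OF degree_mult_le]) auto
  moreover have "poly V (of_real (cos \<theta>)) = of_real (cos (real (Suc (Suc n)) * \<theta>))" for \<theta>
  proof -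
    have "cos (real (Suc n) * \<theta> + \<theta>) + cos (real (Suc n) * \<theta> - \<theta>) = 2 * cos \<theta> * cos (real (Suc n) * \<theta>)"
      by (simp only: cos_add cos_diff) simp
    then have "cos (real (Suc (Suc n)) * \<theta>) = 2 * cos \<theta> * cos (real (Suc n) * \<theta>) - cos (real n * \<theta>)"
      by (simp add: algebra_simps)
    then show ?thesis
      unfolding V_def by (simp only: poly_diff poly_mult S T of_real_diff of_real_mult) simp
  qed
  ultimately show ?case by blast
qed

text \<open>The intermediate value theorem on each \<open>[x j, x (j + 1)]\<close>. Strict signs at
  the points \<open>x j\<close> put the zeros inside the open subintervals, so they are distinct and
  avoid both ends; this matters when \<open>x 0\<close> and \<open>x n\<close> are a full period
  apart.\<close>

lemma alternating_signs_zeros: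
  fixes F :: "real \<Rightarrow> real" and x :: "nat \<Rightarrow> real"
  assumes "continuous_on UNIV F"
    and "\<And>j. j < n \<Longrightarrow> x j < x (Suc j)"
    and "\<And>j. j \<le> n \<Longrightarrow> (-1) ^ j * F (x j) < 0"
  shows "\<exists>S. finite S \<and> card S = n \<and> S \<subseteq> {x 0<..<x n} \<and> (\<forall>t\<in>S. F t = 0)"
  using assms(2,3)
proof (induction n)
  case 0
  show ?case by (rule exI[of _ "{}"]) simp
next
  case (Suc n)
  then obtain S where S: "finite S" "card S = n" "S \<subseteq> {x 0<..<x n}" "\<forall>t\<in>S. F t = 0"
    by (metis less_Suc_eq le_SucI)
  have lt: "x n < x (Suc n)" using Suc.prems(1) by simp
  have "x 0 \<le> x i" if "i \<le> Suc n" for i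
    using that
  proof (induction i)
    case (Suc i)
    then show ?case using \<open>\<And>j. j < Suc n \<Longrightarrow> x j < x (Suc j)\<close>[of i] by simp
  qed simp
  then have x0n: "x 0 \<le> x n" by simp
  \<comment> \<open>The factor turns the sign change on the last interval into one from negative to
    positive, whatever the parity of \<open>n\<close>.\<close>
  define H where "H = (\<lambda>t. (-1) ^ n * F t)"
  have "continuous_on {x n..x (Suc n)} H"
    unfolding H_def by (intro continuous_intros continuous_on_subset[OF assms(1)]) auto
  moreover have "H (x n) < 0" "0 < H (x (Suc n))"
    using Suc.prems(2)[of n] Suc.prems(2)[of "Suc n"] by (auto simp: H_def)
  ultimately obtain t where t: "x n \<le> t" "t \<le> x (Suc n)" "H t = 0"
    using IVT'[of H "x n" 0 "x (Suc n)"] lt by fastforce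
  have "t \<noteq> x n" "t \<noteq> x (Suc n)" using t(3) \<open>H (x n) < 0\<close> \<open>0 < H (x (Suc n))\<close> by auto
  with t have t': "x n < t" "t < x (Suc n)" "F t = 0" by (auto simp: H_def)
  then have "t \<notin> S" using S(3) by auto
  with S t' lt x0n show ?case
    by (intro exI[of _ "insert t S"]) (auto simp: subset_iff)
qed

text \<open>
  The algebraic case uses \<open>y u = u\<close> and \<open>E = 1\<close>. In the trigonometric case \<open>y u = cis s\<close>,
  where \<open>s\<close> is the curve parameter shifted to the midpoint of \<open>[a,b]\<close>, and \<open>E\<close> is the monomial of
  degree \<open>\<nu> = D / 2\<close>, which clears the negative powers of \<open>cis s\<close>.
\<close>

definition represented_by :: "nat \<Rightarrow> (real \<Rightarrow> complex) \<Rightarrow> complex poly \<Rightarrow> (real \<Rightarrow> complex) \<Rightarrow> bool" where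
  "represented_by D y E g \<longleftrightarrow>
     (\<exists>A. degree A \<le> D \<and> (\<forall>u\<in>{-1..1}. poly A (y u) = poly E (y u) * g u))"

text \<open>
  The last two conditions ensure that the zeros of \<open>F\<close> in a period have distinct cosines, none of
  them \<open>\<plusminus>1\<close>. They only exclude countably many values.
\<close>

lemma comparison_parameters_exist:
  fixes h :: "real \<Rightarrow> real" and M d \<theta>\<^sub>0 r :: real and D :: nat
  assumes D: "D \<ge> 1" and M: "M > 0" and d: "0 < d" "real D * d < pi / 2"
    and r: "r < M * cos (real D * d)"
  shows "\<exists>\<epsilon> M'. 0 < \<epsilon> \<and> real D * (d + \<epsilon>) < pi / 2 \<and> M < M' \<and> M' * cos (real D * \<epsilon>) < M \<and>
      r < M' * cos (real D * (d + \<epsilon>)) \<and> sin (real D * (\<theta>\<^sub>0 - \<epsilon>)) \<noteq> 0 \<and>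
      (\<forall>\<theta>. sin (real D * \<theta>) = 0 \<longrightarrow> \<bar>h \<theta>\<bar> \<noteq> \<bar>M' * cos (real D * (\<theta>\<^sub>0 - \<epsilon>))\<bar>)"
proof -
  have "((\<lambda>\<epsilon>. M * cos (real D * (d + \<epsilon>))) \<longlongrightarrow> M * cos (real D * (d + 0))) (at_right 0)"
    by (intro tendsto_intros)
  then have 1: "\<forall>\<^sub>F \<epsilon> in at_right 0. r < M * cos (real D * (d + \<epsilon>))"
    using r by (intro order_tendstoD(1)) auto
  have "((\<lambda>\<epsilon>. real D * (d + \<epsilon>)) \<longlongrightarrow> real D * (d + 0)) (at_right 0)"
    by (intro tendsto_intros)
  then have 2: "\<forall>\<^sub>F \<epsilon> in at_right 0. real D * (d + \<epsilon>) < pi / 2"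
    using d by (intro order_tendstoD(2)) auto
  from eventually_conj[OF 1 2] obtain \<delta> where \<delta>: "\<delta> > 0"
    "\<And>\<epsilon>. 0 < \<epsilon> \<Longrightarrow> \<epsilon> < \<delta> \<Longrightarrow> r < M * cos (real D * (d + \<epsilon>)) \<and> real D * (d + \<epsilon>) < pi / 2"
    unfolding eventually_at_right_field by auto
  have zeros: "countable {\<theta>. sin (c * \<theta> + e) = 0}" if "c \<noteq> 0" for c e :: real
  proof -
    have "{\<theta>. sin (c * \<theta> + e) = 0} \<subseteq> range (\<lambda>i::int. (of_int i * pi - e) / c)"
      using that by (auto simp: sin_zero_iff_int2 field_simps image_iff)
    then show ?thesis by (rule countable_subset) simp
  qed
  have D0: "real D > 0" using D by simp
  \<comment> \<open>By the double angle formula, one sine to avoid keeps both sine and cosine of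
    \<open>real D * (\<theta>\<^sub>0 - \<epsilon>)\<close> away from 0. The cosine becomes a
    denominator in \<open>bad\<close>.\<close>
  have "countable {\<theta>. sin (- (2 * real D) * \<theta> + 2 * real D * \<theta>\<^sub>0) = 0}"
    using D0 by (intro zeros) auto
  then obtain \<epsilon> where \<epsilon>: "0 < \<epsilon>" "\<epsilon> < \<delta>" and "sin (- (2 * real D) * \<epsilon> + 2 * real D * \<theta>\<^sub>0) \<noteq> 0"
    using real_interval_avoid_countable_set[OF \<delta>(1)] by (metis (lifting) greaterThanLessThan_iff mem_Collect_eq)
  then have "sin (2 * (real D * (\<theta>\<^sub>0 - \<epsilon>))) \<noteq> 0"
    by (simp add: algebra_simps)
  then have sc: "sin (real D * (\<theta>\<^sub>0 - \<epsilon>)) \<noteq> 0" "cos (real D * (\<theta>\<^sub>0 - \<epsilon>)) \<noteq> 0"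
    unfolding sin_double by auto
  have "0 < real D * \<epsilon>" "0 < real D * d" using D0 d \<epsilon> by auto
  moreover have r': "r < M * cos (real D * (d + \<epsilon>))" "real D * (d + \<epsilon>) < pi / 2"
    using \<delta>(2) \<epsilon> by auto
  moreover have "real D * (d + \<epsilon>) = real D * d + real D * \<epsilon>" by (simp add: algebra_simps)
  ultimately have "0 < cos (real D * (d + \<epsilon>))" "0 < cos (real D * \<epsilon>)" "cos (real D * \<epsilon>) < cos 0"
    by (intro cos_gt_zero_pi cos_monotone_0_pi; use pi_gt_zero in linarith)+
  then have c: "0 < cos (real D * (d + \<epsilon>))" "0 < cos (real D * \<epsilon>)" "cos (real D * \<epsilon>) < 1" by auto
  \<comment> \<open>The moduli of \<open>M'\<close> that would violate the last condition: one for
    each zero \<theta> of \<open>sin (real D * \<theta>)\<close>, hence countably many.\<close>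
  define bad where "bad = (\<lambda>\<theta>. \<bar>h \<theta>\<bar> / \<bar>cos (real D * (\<theta>\<^sub>0 - \<epsilon>))\<bar>) ` {\<theta>. sin (real D * \<theta>) = 0}"
  have "countable bad"
    unfolding bad_def using zeros[of "real D" 0] D0 by auto
  \<comment> \<open>The interval from \<open>M\<close> to
    \<open>M / cos (real D * \<epsilon>)\<close> consists of the \<open>M'\<close> with
    \<open>M < M'\<close> and \<open>M' * cos (real D * \<epsilon>) < M\<close>; being nonempty and
    open, it contains a value outside \<open>bad\<close>.\<close>
  moreover have "M < M / cos (real D * \<epsilon>)" using M c by (simp add: field_simps)
  ultimately obtain M' where M': "M < M'" "M' < M / cos (real D * \<epsilon>)" "M' \<notin> bad"
    using real_interval_avoid_countable_set by (metis (lifting) greaterThanLessThan_iff)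
  have "\<bar>h \<theta>\<bar> \<noteq> \<bar>M' * cos (real D * (\<theta>\<^sub>0 - \<epsilon>))\<bar>" if "sin (real D * \<theta>) = 0" for \<theta>
    using M' M sc that by (auto simp: bad_def image_iff abs_mult field_simps)
  moreover have "M' * cos (real D * \<epsilon>) < M" using M' c by (simp add: field_simps)
  moreover have "r < M' * cos (real D * (d + \<epsilon>))"
    using r' M' c mult_strict_right_mono[of M M' "cos (real D * (d + \<epsilon>))"] by linarith
  ultimately show ?thesis using \<epsilon> r' M' sc by blast
qed

text \<open>The map \<open>y \<circ> cos\<close> sends the zeros in \<open>S\<close> injectively to
  roots of a nonzero polynomial \<open>P\<close> of degree at most \<open>2 * D\<close>. The product
  of \<open>F\<close> at \<theta> and at -\<theta> is even, which is why it can be written in terms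
  of \<open>cos \<theta>\<close>.\<close>

lemma card_comparison_zeros_le:
  fixes G :: "real \<Rightarrow> real" and y :: "real \<Rightarrow> complex" and D :: nat and E :: "complex poly"
  assumes D: "D \<ge> 1"
    and y: "inj_on y {-1<..<1}" "degree E \<le> D" "\<And>u. u \<in> {-1..1} \<Longrightarrow> poly E (y u) \<noteq> 0"
    and G: "represented_by D y E (\<lambda>u. of_real (G u))"
    and C: "represented_by D y E (\<lambda>u. of_real (cos (real D * arccos u)))"
    and M: "M \<noteq> 0" and \<phi>: "sin (real D * \<phi>) \<noteq> 0"
    and generic: "\<And>\<theta>. sin (real D * \<theta>) = 0 \<Longrightarrow> \<bar>G (cos \<theta>)\<bar> \<noteq> \<bar>M * cos (real D * \<phi>)\<bar>"
    and S: "finite S" "S \<subseteq> {t<..<t + 2 * pi}"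
    and zero: "\<And>\<theta>. \<theta> \<in> S \<Longrightarrow> G (cos \<theta>) = M * cos (real D * (\<theta> - \<phi>))"
  shows "card S \<le> 2 * D"
proof -
  obtain A where A: "degree A \<le> D" "\<And>u. u \<in> {-1..1} \<Longrightarrow> poly A (y u) = poly E (y u) * of_real (G u)"
    using G unfolding represented_by_def by blast
  obtain B where B: "degree B \<le> D"
    "\<And>u. u \<in> {-1..1} \<Longrightarrow> poly B (y u) = poly E (y u) * of_real (cos (real D * arccos u))"
    using C unfolding represented_by_def by blast
  \<comment> \<open>Outside \<open>[0, pi]\<close> the angle \<open>arccos (cos \<theta>)\<close>
    differs from \<theta>, but \<open>cos (real D * \<theta>)\<close> depends on
    \<open>cos \<theta>\<close> only, through a polynomial.\<close>
  have cos_arccos_mult: "cos (real D * arccos (cos \<theta>)) = cos (real D * \<theta>)" for \<theta>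
  proof -
    obtain T :: "complex poly" where T: "\<And>\<theta>. poly T (of_real (cos \<theta>)) = of_real (cos (real D * \<theta>))"
      using chebyshev_polynomial_exists[of D] by blast
    have "complex_of_real (cos (real D * arccos (cos \<theta>))) = of_real (cos (real D * \<theta>))"
      unfolding T[symmetric] by (simp add: cos_arccos)
    then show ?thesis by (simp only: of_real_eq_iff)
  qed
  define sn cs where "sn = sin (real D * \<phi>)" and "cs = cos (real D * \<phi>)"
  define F where "F = (\<lambda>\<theta>. G (cos \<theta>) - M * cos (real D * (\<theta> - \<phi>)))"
  define P where "P = A * A - smult (of_real (2 * M * cs)) (A * B) + smult (of_real (M\<^sup>2)) (B * B)
      - smult (of_real (M\<^sup>2 * sn\<^sup>2)) (E * E)"
  have deg2: "degree (U * V) \<le> 2 * D" if "degree U \<le> D" "degree V \<le> D" for U V :: "complex poly"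
    using degree_mult_le[of U V] that by linarith
  have degP: "degree P \<le> 2 * D"
    unfolding P_def using A(1) B(1) y(2)
    by (intro degree_diff_le degree_add_le order_trans[OF degree_smult_le] deg2) auto
  have P: "poly P (y (cos \<theta>)) = poly E (y (cos \<theta>)) ^ 2 * of_real (F \<theta> * F (- \<theta>))" for \<theta>
  proof -
    have u: "cos \<theta> \<in> {-1..1}" by simp
    define X Y where "X = cos (real D * \<theta>)" and "Y = sin (real D * \<theta>)"
    have F1: "F \<theta> = G (cos \<theta>) - M * (X * cs + Y * sn)"
      and F2: "F (- \<theta>) = G (cos \<theta>) - M * (X * cs - Y * sn)"
      unfolding F_def X_def Y_def sn_def cs_def
      by (simp_all add: cos_add cos_diff right_diff_distrib)
    have XY: "Y\<^sup>2 = 1 - X\<^sup>2" and sc: "cs\<^sup>2 = 1 - sn\<^sup>2"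
      unfolding X_def Y_def sn_def cs_def by (simp_all add: cos_squared_eq)
    have "F \<theta> * F (- \<theta>) = (G (cos \<theta>))\<^sup>2 - 2 * M * cs * G (cos \<theta>) * X + M\<^sup>2 * (X\<^sup>2 * cs\<^sup>2 - Y\<^sup>2 * sn\<^sup>2)"
      unfolding F1 F2 by (simp add: algebra_simps power2_eq_square)
    also have "X\<^sup>2 * cs\<^sup>2 - Y\<^sup>2 * sn\<^sup>2 = X\<^sup>2 - sn\<^sup>2"
      unfolding XY sc by (simp add: algebra_simps)
    finally have FF: "F \<theta> * F (- \<theta>) = (G (cos \<theta>))\<^sup>2 - 2 * M * cs * G (cos \<theta>) * X + M\<^sup>2 * (X\<^sup>2 - sn\<^sup>2)" .
    have B': "poly B (y (cos \<theta>)) = poly E (y (cos \<theta>)) * of_real X"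
      unfolding B(2)[OF u] X_def cos_arccos_mult ..
    show ?thesis
      unfolding P_def FF by (simp add: A(2)[OF u] B' algebra_simps power2_eq_square)
  qed
  \<comment> \<open>At angle 0 both factors of the product equal \<open>F 0\<close>, and
    \<open>generic\<close> at 0 excludes \<open>G 1 = M * cos (real D * \<phi>)\<close>. This is how
    \<open>P\<close> is seen to be nonzero.\<close>
  have "F 0 \<noteq> 0"
    using generic[of 0] by (auto simp: F_def)
  then have "poly P (y (cos 0)) \<noteq> 0"
    unfolding P using y(3)[of "cos 0"] by simp
  then have P0: "P \<noteq> 0" by auto
  \<comment> \<open>If the sine vanished, \<open>cos (real D * (\<theta> - \<phi>))\<close> would be
    plus or minus \<open>cos (real D * \<phi>)\<close>, and a zero of \<open>F\<close> there is what
    \<open>generic\<close> forbids.\<close>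
  have sin0: "sin (real D * \<theta>) \<noteq> 0" if "\<theta> \<in> S" for \<theta>
  proof
    assume *: "sin (real D * \<theta>) = 0"
    then have "\<bar>cos (real D * \<theta>)\<bar> = 1" by (rule sin_zero_abs_cos_one)
    then have "\<bar>G (cos \<theta>)\<bar> = \<bar>M * cos (real D * \<phi>)\<bar>"
      using zero[OF that] * by (simp add: right_diff_distrib cos_diff abs_mult)
    with generic[OF *] show False by simp
  qed
  have inj: "inj_on cos S"
  proof (rule inj_onI, rule ccontr)
    fix \<theta> \<theta>' assume *: "\<theta> \<in> S" "\<theta>' \<in> S" "cos \<theta> = cos \<theta>'" "\<theta> \<noteq> \<theta>'"
    then obtain i :: int where i: "\<theta> = \<theta>' + 2 * of_int i * pi \<or> \<theta> = - \<theta>' + 2 * of_int i * pi"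
      by (auto simp: cos_eq Ints_def)
    have cpi: "cos (2 * pi * of_int i * real D + x) = cos x" for x
      using cos_int_2pin[of "i * int D"] sin_int_2pin[of "i * int D"] by (simp add: cos_add mult.assoc)
    from i show False
    proof
      assume e: "\<theta> = \<theta>' + 2 * of_int i * pi"
      have "\<bar>\<theta> - \<theta>'\<bar> < 2 * pi" using subsetD[OF S(2) *(1)] subsetD[OF S(2) *(2)] by auto
      then have "\<bar>of_int i * (2 * pi)\<bar> < 1 * (2 * pi)" unfolding e by (simp add: mult_ac)
      then have "\<bar>real_of_int i\<bar> < 1" unfolding abs_mult by simp
      then have "i = 0" by linarith
      with e *(4) show False by simp
    next
      \<comment> \<open>Two zeros that are reflections of each other have the same value of
        \<open>G\<close>, so the cosine takes equal values at \<open>\<theta>' + \<phi>\<close> and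
        \<open>\<theta>' - \<phi>\<close> (scaled by \<open>D\<close>). Their difference is a
        product of two sines, both nonzero.\<close>
      assume e: "\<theta> = - \<theta>' + 2 * of_int i * pi"
      have "M * cos (real D * (\<theta> - \<phi>)) = M * cos (real D * (\<theta>' - \<phi>))"
        unfolding zero[OF *(1), symmetric] zero[OF *(2), symmetric] by (simp only: *(3))
      moreover have "M \<noteq> 0" by (rule M)
      ultimately have "cos (real D * (\<theta> - \<phi>)) = cos (real D * (\<theta>' - \<phi>))" by simp
      moreover have "cos (real D * (\<theta> - \<phi>)) = cos (2 * pi * of_int i * real D + - real D * (\<theta>' + \<phi>))"
        unfolding e by (simp add: algebra_simps)
      moreover have "cos (- real D * (\<theta>' + \<phi>)) = cos (real D * (\<theta>' + \<phi>))"
        unfolding mult_minus_left by (rule cos_minus)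
      ultimately have "cos (real D * (\<theta>' + \<phi>)) = cos (real D * (\<theta>' - \<phi>))"
        unfolding cpi by simp
      then have "sin (real D * \<theta>') * sin (real D * \<phi>) = 0"
        by (simp add: distrib_left right_diff_distrib cos_add cos_diff)
      with sin0[OF *(2)] \<phi> show False by simp
    qed
  qed
  \<comment> \<open>The ends are excluded because \<open>y\<close> is injective on the open interval
    only: for a trigonometric curve over a full period, \<open>cis\<close> takes the same value at
    both ends.\<close>
  have "cos ` S \<subseteq> {-1<..<1}"
  proof safe
    fix \<theta> assume "\<theta> \<in> S"
    have "sin \<theta> \<noteq> 0"
    proof
      assume "sin \<theta> = 0"
      then obtain i :: int where "\<theta> = of_int i * pi" by (auto simp: sin_zero_iff_int2)
      then have "sin (real D * \<theta>) = 0"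
        by (auto simp: sin_zero_iff_int2 intro!: exI[of _ "int D * i"])
      with sin0[OF \<open>\<theta> \<in> S\<close>] show False by simp
    qed
    then have "0 < (sin \<theta>)\<^sup>2" by simp
    then have "(cos \<theta>)\<^sup>2 < 1\<^sup>2" unfolding cos_squared_eq by simp
    then have "\<bar>cos \<theta>\<bar> < 1" using abs_square_less_1 by force
    then show "cos \<theta> \<in> {-1<..<1}"
      by (simp add: abs_less_iff)
  qed
  then have "inj_on (y \<circ> cos) S"
    using inj y(1) by (auto intro: comp_inj_on inj_on_subset)
  then have "card S = card ((y \<circ> cos) ` S)" by (rule card_image[symmetric])
  also have "\<dots> \<le> card {w. poly P w = 0}"
  proof (rule card_mono)
    show "finite {w. poly P w = 0}" using P0 by (rule poly_roots_finite)
    show "(y \<circ> cos) ` S \<subseteq> {w. poly P w = 0}"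
      using zero by (auto simp: P F_def)
  qed
  also have "\<dots> \<le> degree P" using P0 by (rule card_poly_roots_bound)
  also have "\<dots> \<le> 2 * D" by (rule degP)
  finally show ?thesis .
qed

text \<open>A cosine of amplitude \<open>M'\<close> and frequency \<open>D\<close> already forces
  one sign change of \<open>F\<close> between consecutive extrema, \<open>2 * D\<close> in a period.
  A failure at \<open>\<theta>\<^sub>0 + d\<close> adds two more between the first two extrema,
  contradicting the zero count.\<close>

lemma comparison_right:
  fixes G :: "real \<Rightarrow> real" and y :: "real \<Rightarrow> complex" and D :: nat and E :: "complex poly"
  assumes D: "D \<ge> 1"
    and y: "inj_on y {-1<..<1}" "degree E \<le> D" "\<And>u. u \<in> {-1..1} \<Longrightarrow> poly E (y u) \<noteq> 0"
    and G: "represented_by D y E (\<lambda>u. of_real (G u))"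
    and C: "represented_by D y E (\<lambda>u. of_real (cos (real D * arccos u)))"
    and cont: "continuous_on {-1..1} G"
    and bound: "\<And>u. u \<in> {-1..1} \<Longrightarrow> \<bar>G u\<bar> \<le> M" and M: "M > 0"
    and max: "G (cos \<theta>\<^sub>0) = M"
    and d: "0 < d" "real D * d < pi / 2"
  shows "M * cos (real D * d) \<le> G (cos (\<theta>\<^sub>0 + d))"
proof (rule ccontr)
  assume "\<not> ?thesis"
  then have "G (cos (\<theta>\<^sub>0 + d)) < M * cos (real D * d)" by simp
  from comparison_parameters_exist[OF D M d this, of \<theta>\<^sub>0 "\<lambda>\<theta>. G (cos \<theta>)"]
  obtain \<epsilon> M' where \<epsilon>: "0 < \<epsilon>" "real D * (d + \<epsilon>) < pi / 2"
    and M': "M < M'" "M' * cos (real D * \<epsilon>) < M" "G (cos (\<theta>\<^sub>0 + d)) < M' * cos (real D * (d + \<epsilon>))"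
    and generic: "sin (real D * (\<theta>\<^sub>0 - \<epsilon>)) \<noteq> 0"
      "\<And>\<theta>. sin (real D * \<theta>) = 0 \<Longrightarrow> \<bar>G (cos \<theta>)\<bar> \<noteq> \<bar>M' * cos (real D * (\<theta>\<^sub>0 - \<epsilon>))\<bar>"
    by blast
  define \<phi> where "\<phi> = \<theta>\<^sub>0 - \<epsilon>"
  define F where "F = (\<lambda>\<theta>. G (cos \<theta>) - M' * cos (real D * (\<theta> - \<phi>)))"
  \<comment> \<open>The extrema of the shifted cosine over one period, with
    \<open>\<theta>\<^sub>0\<close> and \<open>\<theta>\<^sub>0 + d\<close> inserted after the
    first. The two insertions explain the offset \<open>j - 2\<close>; the last point is
    \<open>\<phi> + 2 * pi\<close>.\<close>
  define x where "x = (\<lambda>j. if j = 0 then \<phi> else if j = 1 then \<theta>\<^sub>0 else if j = 2 then \<theta>\<^sub>0 + d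
      else \<phi> + real (j - 2) * pi / real D)"
  have D0: "real D > 0" using D by simp
  have "continuous_on UNIV F"
    unfolding F_def
    by (intro continuous_intros continuous_on_compose2[OF cont]) auto
  moreover have "x j < x (Suc j)" if "j < 2 * D + 2" for j
  proof -
    consider "j = 0" | "j = 1" | "j = 2" | "j \<ge> 3" by linarith
    then show ?thesis
    proof cases
      case 3
      \<comment> \<open>The inserted point
        \<open>\<theta>\<^sub>0 + d = \<phi> + \<epsilon> + d\<close> stays before the next extremum
        \<open>\<phi> + pi / D\<close>.\<close>
      have "real D * (d + \<epsilon>) < pi" using \<epsilon> pi_gt_zero by linarith
      then have "d + \<epsilon> < pi / real D" using D0 by (simp add: field_simps)
      then show ?thesis using 3 by (simp add: x_def \<phi>_def)
    next
      case 4
      then show ?thesis using D0 by (simp add: x_def divide_strict_right_mono)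
    qed (use \<epsilon> d in \<open>auto simp: x_def \<phi>_def\<close>)
  qed
  moreover have "(-1) ^ j * F (x j) < 0" if "j \<le> 2 * D + 2" for j
  proof -
    consider "j = 0" | "j = 1" | "j = 2" | "j \<ge> 3" by linarith
    then show ?thesis
    proof cases
      case 1
      then show ?thesis using bound[of "cos \<phi>"] M' by (simp add: x_def F_def)
    next
      case 2
      then show ?thesis using max M' by (simp add: x_def F_def \<phi>_def)
    next
      case 3
      then show ?thesis using M' by (simp add: x_def F_def \<phi>_def algebra_simps)
    next
      case 4
      then obtain i where i: "j = i + 2" "i \<ge> 1" by (intro that[of "j - 2"]) auto
      have "F (x j) = G (cos (x j)) - M' * (-1) ^ i"
        using i D0 by (simp add: F_def x_def cos_npi)
      moreover have "\<bar>G (cos (x j))\<bar> < M'" using bound[of "cos (x j)"] M' by simp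
      ultimately show ?thesis using i(1) by (cases "even i") auto
    qed
  qed
  ultimately obtain S where S: "finite S" "card S = 2 * D + 2" "S \<subseteq> {x 0<..<x (2 * D + 2)}" "\<forall>t\<in>S. F t = 0"
    using alternating_signs_zeros[of F "2 * D + 2" x] by blast
  have "x (2 * D + 2) = x 0 + 2 * pi" using D D0 by (simp add: x_def)
  with S have "card S \<le> 2 * D"
    using generic M M'(1)
    by (intro card_comparison_zeros_le[OF D y G C, of M' \<phi> S "x 0"]) (auto simp: F_def \<phi>_def)
  with S(2) show False by simp
qed

lemma comparison:
  fixes G :: "real \<Rightarrow> real" and y :: "real \<Rightarrow> complex" and D :: nat and E :: "complex poly"
  assumes D: "D \<ge> 1"
    and y: "inj_on y {-1<..<1}" "degree E \<le> D" "\<And>u. u \<in> {-1..1} \<Longrightarrow> poly E (y u) \<noteq> 0"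
    and G: "represented_by D y E (\<lambda>u. of_real (G u))"
    and C: "represented_by D y E (\<lambda>u. of_real (cos (real D * arccos u)))"
    and cont: "continuous_on {-1..1} G"
    and bound: "\<And>u. u \<in> {-1..1} \<Longrightarrow> \<bar>G u\<bar> \<le> M" and M: "M > 0"
    and max: "G (cos \<theta>\<^sub>0) = M"
    and d: "real D * \<bar>d\<bar> < pi / 2"
  shows "M * cos (real D * d) \<le> G (cos (\<theta>\<^sub>0 + d))"
proof -
  consider "d = 0" | "0 < d" | "0 < - d" by linarith
  then show ?thesis
  proof cases
    case 2
    then show ?thesis using d by (intro comparison_right[OF D y G C cont bound M max]) auto
  next
    case 3
    \<comment> \<open>Since cosine is even, a negative \<open>d\<close> is handled by reflecting
      both \<open>\<theta>\<^sub>0\<close> and \<open>d\<close>.\<close>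
    have "M * cos (real D * - d) \<le> G (cos (- \<theta>\<^sub>0 + - d))"
      using d 3 max by (intro comparison_right[OF D y G C cont bound M]) auto
    also have "cos (- \<theta>\<^sub>0 + - d) = cos (\<theta>\<^sub>0 + d)"
      by (metis cos_minus minus_add_distrib)
    finally show ?thesis by simp
  qed (use max in simp)
qed

section \<open>Norming by Chebyshev points\<close>

text \<open>Cut \<open>[0, pi]\<close> into \<open>N\<close> cells of length \<open>pi / N\<close>.
  The angles of the zeros are the cell midpoints and those of the extrema the cell ends, so a node
  always lies within half a cell.\<close>

lemma nearest_chebyshev_angle:
  assumes N: "N \<ge> 1" and \<theta>: "0 \<le> \<theta>" "\<theta> \<le> pi"
  shows "\<exists>d. \<bar>d\<bar> \<le> pi / (2 * real N) \<and> cos (\<theta> + d) \<in> chebyshev_points \<kappa> N"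
proof (cases \<kappa>)
  case Zeros
  define x where "x = \<theta> * real N / pi"
  have x: "0 \<le> x" "x \<le> real N" using \<theta> N by (auto simp: x_def field_simps)
  \<comment> \<open>Here \<open>x\<close> is the angle in units of one cell and the ceiling is the
    cell number. The maximum with 1 assigns \<open>x = 0\<close> to the first cell.\<close>
  define j where "j = max 1 (nat \<lceil>x\<rceil>)"
  have j: "1 \<le> j" "j \<le> N" using x N by (auto simp: j_def ceiling_le_iff nat_le_iff)
  have jx: "\<bar>(2 * real j - 1) / 2 - x\<bar> \<le> 1 / 2"
  proof (cases "x = 0")
    case False
    then have "0 < \<lceil>x\<rceil>" using x by simp
    then have "1 \<le> nat \<lceil>x\<rceil>" by linarith
    then have "real j = of_int \<lceil>x\<rceil>" by (simp add: j_def)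
    then show ?thesis using ceiling_correct[of x] by (simp add: abs_le_iff field_simps)
  qed (simp add: j_def)
  have "\<bar>(2 * real j - 1) * pi / (2 * real N) - \<theta>\<bar> = \<bar>(2 * real j - 1) / 2 - x\<bar> * (pi / real N)"
    using N unfolding x_def by (simp add: abs_mult[symmetric] abs_divide[symmetric] field_simps abs_if)
  also have "\<dots> \<le> 1 / 2 * (pi / real N)"
    using jx by (intro mult_right_mono) auto
  finally show ?thesis
    using j Zeros by (intro exI[of _ "(2 * real j - 1) * pi / (2 * real N) - \<theta>"]) auto
next
  case Extrema
  define x where "x = \<theta> * real N / pi"
  have x: "0 \<le> x" "x \<le> real N" using \<theta> N by (auto simp: x_def field_simps)
  define j where "j = nat (round x)"
  have r: "0 \<le> round x" "round x \<le> int N"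
    using x round_mono[of 0 x] round_mono[of x "real N"] by auto
  then have j: "j \<le> N" and rj: "real j = of_int (round x)" by (auto simp: j_def)
  have "\<bar>real j * pi / real N - \<theta>\<bar> = \<bar>of_int (round x) - x\<bar> * (pi / real N)"
    using N unfolding x_def rj by (simp add: abs_mult[symmetric] abs_divide[symmetric] field_simps abs_if)
  also have "\<dots> \<le> 1 / 2 * (pi / real N)"
    using of_int_round_abs_le[of x] by (intro mult_right_mono) auto
  finally show ?thesis
    using j Extrema by (intro exI[of _ "real j * pi / real N - \<theta>"]) auto
qed

lemma chebyshev_points_subset: "chebyshev_points \<kappa> N \<subseteq> {-1..1}"
  by (cases \<kappa>) auto

lemma finite_chebyshev_points: "finite (chebyshev_points \<kappa> N)"
  by (cases \<kappa>) auto

lemma chebyshev_points_nonempty: "N \<ge> 1 \<Longrightarrow> chebyshev_points \<kappa> N \<noteq> {}"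
  using nearest_chebyshev_angle[of N 0 \<kappa>] by auto

lemma card_chebyshev_points_le: "card (chebyshev_points \<kappa> N) \<le> N + 1"
proof (cases \<kappa>)
  case Zeros
  then show ?thesis using le_SucI[OF card_image_le[of "{1..N}"]] by simp
next
  case Extrema
  then show ?thesis using card_image_le[of "{0..N}"] by simp
qed

text \<open>The node is chosen near a maximum point \<open>w\<close> of the modulus of
  \<open>f\<close>, not near \<open>u\<close>. The rotating factor depends on \<open>f w\<close>, so
  representability is assumed for every \<open>c\<close>.\<close>

lemma represented_norming:
  fixes f :: "real \<Rightarrow> complex" and y :: "real \<Rightarrow> complex" and D N :: nat and E :: "complex poly"
  assumes D: "D \<ge> 1" and N: "D < N"
    and y: "inj_on y {-1<..<1}" "degree E \<le> D" "\<And>u. u \<in> {-1..1} \<Longrightarrow> poly E (y u) \<noteq> 0"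
    and f: "\<And>c. represented_by D y E (\<lambda>u. of_real (Re (c * f u)))"
    and C: "represented_by D y E (\<lambda>u. of_real (cos (real D * arccos u)))"
    and cont: "continuous_on {-1..1} f" and u: "u \<in> {-1..1}"
  shows "\<exists>v\<in>chebyshev_points \<kappa> N. norm (f u) * cos (real D * pi / (2 * real N)) \<le> norm (f v)"
proof -
  have "continuous_on {-1..1} (\<lambda>u. norm (f u))" by (intro continuous_intros cont)
  then obtain w where w: "w \<in> {-1..1}" "\<And>u. u \<in> {-1..1} \<Longrightarrow> norm (f u) \<le> norm (f w)"
    using continuous_attains_sup[of "{-1..1::real}" "\<lambda>u. norm (f u)"] by auto
  define M where "M = norm (f w)"
  define \<theta> where "\<theta> = arccos w"
  have \<theta>: "0 \<le> \<theta>" "\<theta> \<le> pi" "cos \<theta> = w"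
    using w by (auto simp: \<theta>_def arccos_lbound arccos_ubound)
  obtain d where d: "\<bar>d\<bar> \<le> pi / (2 * real N)" "cos (\<theta> + d) \<in> chebyshev_points \<kappa> N"
    using nearest_chebyshev_angle[of N \<theta> \<kappa>] N \<theta> by auto
  have "real D * \<bar>d\<bar> \<le> real D * (pi / (2 * real N))" using d by (intro mult_left_mono) auto
  then have Dd: "real D * \<bar>d\<bar> \<le> real D * pi / (2 * real N)" by simp
  have DN: "real D * pi / (2 * real N) < pi / 2" using N by (simp add: field_simps)
  define c where "c = cos (real D * pi / (2 * real N))"
  have "0 \<le> c" unfolding c_def using DN D N by (intro cos_ge_zero) (auto intro: order_trans[of _ 0])
  have "norm (f u) * c \<le> M * c"
    unfolding M_def using w(2)[OF u] \<open>0 \<le> c\<close> by (rule mult_right_mono)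
  also have "M * c \<le> norm (f (cos (\<theta> + d)))"
  proof (cases "M = 0")
    case False
    then have M: "M > 0" by (simp add: M_def)
    \<comment> \<open>The unimodular factor that rotates \<open>f w\<close> to the positive real
      number \<open>M\<close>; the comparison is applied to the real part of
      \<open>e * f\<close>.\<close>
    define e where "e = cnj (f w) / of_real M"
    have e: "norm e = 1" using M by (simp add: e_def norm_divide M_def)
    have le: "\<bar>Re (e * f u)\<bar> \<le> norm (f u)" for u
      using abs_Re_le_cmod[of "e * f u"] e by (simp add: norm_mult)
    have "e * f w = of_real M"
      using M by (simp add: e_def M_def complex_norm_square[symmetric] mult.commute power2_eq_square)
    then have "M * cos (real D * d) \<le> Re (e * f (cos (\<theta> + d)))"
      using \<theta> w(2) order_trans[OF le] M le_less_trans[OF Dd DN]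
      by (intro comparison[OF D y f C]) (auto intro!: continuous_intros cont simp: M_def simp del: times_divide_eq_right)
    moreover have "c \<le> cos (real D * d)"
    proof -
      have "c \<le> cos (real D * \<bar>d\<bar>)"
        unfolding c_def
      proof (rule cos_monotone_0_pi_le[OF _ Dd])
        show "real D * pi / (2 * real N) \<le> pi" using DN pi_gt_zero by linarith
      qed simp
      also have "\<dots> = cos (real D * d)" by (auto simp: abs_if)
      finally show ?thesis .
    qed
    then have "M * c \<le> M * cos (real D * d)" using M by simp
    ultimately show ?thesis using le[of "cos (\<theta> + d)"] by linarith
  qed simp
  finally show ?thesis using d(2) unfolding c_def by blast
qed

lemma algebraic_norming:
  fixes Q :: "complex poly"
  assumes "degree Q \<le> D" "D \<ge> 1" "D < N" "u \<in> {-1..1}"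
  shows "\<exists>v\<in>chebyshev_points \<kappa> N.
    norm (poly Q (of_real u)) * cos (real D * pi / (2 * real N)) \<le> norm (poly Q (of_real v))"
proof (rule represented_norming[where y = of_real and E = 1])
  fix c :: complex
  \<comment> \<open>Conjugating the coefficients conjugates the values at real points, so averaging
    gives a polynomial that equals the real part on the real line.\<close>
  let ?R = "smult (1 / 2) (smult c Q + map_poly cnj (smult c Q))"
  have "degree (map_poly cnj (smult c Q)) \<le> D"
    using assms(1) map_poly_degree_leq[of cnj "smult c Q"] degree_smult_le[of c Q] by linarith
  then have "degree ?R \<le> D"
    using assms(1) degree_smult_le[of c Q] by (intro order_trans[OF degree_smult_le] degree_add_le) auto
  moreover have "poly ?R (of_real u) = of_real (Re (c * poly Q (of_real u)))" for u
    by (simp add: complex_eq_iff)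
  ultimately show "represented_by D of_real 1 (\<lambda>u. of_real (Re (c * poly Q (of_real u))))"
    unfolding represented_by_def by (intro exI[of _ ?R]) (simp del: poly_add poly_smult)
next
  obtain T :: "complex poly" where "degree T \<le> D"
    "\<And>\<theta>. poly T (of_real (cos \<theta>)) = of_real (cos (real D * \<theta>))"
    using chebyshev_polynomial_exists[of D] by blast
  moreover from this(2) have "poly T (of_real u) = of_real (cos (real D * arccos u))" if "u \<in> {-1..1}" for u
    using that by (metis atLeastAtMost_iff cos_arccos)
  ultimately show "represented_by D of_real 1 (\<lambda>u. of_real (cos (real D * arccos u)))"
    unfolding represented_by_def by auto
qed (use assms in \<open>auto intro!: continuous_intros simp: inj_on_def\<close>)

section \<open>Trigonometric polynomials\<close>

text \<open>Laurent polynomials in \<open>cis s\<close> with exponents from -\<nu> to \<nu>; the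
  factor \<open>cis s ^ \<nu>\<close> shifts the exponents to 0 up to \<open>2 * \<nu>\<close>, so
  that ordinary polynomial roots can be counted.\<close>

definition trigpoly :: "nat \<Rightarrow> (real \<Rightarrow> complex) \<Rightarrow> bool" where
  "trigpoly \<nu> f \<longleftrightarrow> (\<exists>A. degree A \<le> 2 * \<nu> \<and> (\<forall>s. cis s ^ \<nu> * f s = poly A (cis s)))"

lemma trigpoly_mono:
  assumes "trigpoly \<nu> f" "\<nu> \<le> \<mu>"
  shows "trigpoly \<mu> f"
proof -
  obtain A where A: "degree A \<le> 2 * \<nu>" "\<And>s. cis s ^ \<nu> * f s = poly A (cis s)"
    using assms unfolding trigpoly_def by blast
  have "degree (monom 1 (\<mu> - \<nu>) * A) \<le> 2 * \<mu>"
    using degree_mult_le[of "monom 1 (\<mu> - \<nu>)" A] degree_monom_le[of "1::complex" "\<mu> - \<nu>"] A(1) assms(2)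
    by linarith
  moreover have "cis s ^ \<mu> * f s = poly (monom 1 (\<mu> - \<nu>) * A) (cis s)" for s
  proof -
    have "cis s ^ \<mu> = cis s ^ (\<mu> - \<nu>) * cis s ^ \<nu>" using assms(2) by (simp flip: power_add)
    then show ?thesis using A(2)[of s] by (simp add: poly_monom mult.assoc)
  qed
  ultimately show ?thesis unfolding trigpoly_def by blast
qed

lemma trigpoly_const: "trigpoly \<nu> (\<lambda>_. c)"
  unfolding trigpoly_def
  by (rule exI[of _ "monom c \<nu>"]) (auto simp: poly_monom mult.commute intro: order_trans[OF degree_monom_le])

lemma trigpoly_add:
  assumes "trigpoly \<nu> f" "trigpoly \<nu> g"
  shows "trigpoly \<nu> (\<lambda>s. f s + g s)"
proof -
  obtain A B where "degree A \<le> 2 * \<nu>" "\<And>s. cis s ^ \<nu> * f s = poly A (cis s)"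
    and "degree B \<le> 2 * \<nu>" "\<And>s. cis s ^ \<nu> * g s = poly B (cis s)"
    using assms unfolding trigpoly_def by blast
  then show ?thesis
    unfolding trigpoly_def by (intro exI[of _ "A + B"]) (auto simp: distrib_left intro: degree_add_le)
qed

lemma trigpoly_mult:
  assumes "trigpoly \<nu> f" "trigpoly \<mu> g"
  shows "trigpoly (\<nu> + \<mu>) (\<lambda>s. f s * g s)"
proof -
  obtain A B where A: "degree A \<le> 2 * \<nu>" "\<And>s. cis s ^ \<nu> * f s = poly A (cis s)"
    and B: "degree B \<le> 2 * \<mu>" "\<And>s. cis s ^ \<mu> * g s = poly B (cis s)"
    using assms unfolding trigpoly_def by metis
  have "degree (A * B) \<le> 2 * (\<nu> + \<mu>)" using degree_mult_le[of A B] A(1) B(1) by simp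
  moreover have "cis s ^ (\<nu> + \<mu>) * (f s * g s) = poly (A * B) (cis s)" for s
    by (simp add: power_add mult_ac flip: A(2) B(2))
  ultimately show ?thesis unfolding trigpoly_def by blast
qed

text \<open>On the unit circle conjugation is inversion, so it sends exponent \<open>i\<close> of
  \<open>A\<close> to \<open>2 * \<nu> - i\<close>: \<open>B\<close> is the reversed polynomial with
  conjugated coefficients.\<close>

lemma trigpoly_cnj:
  assumes "trigpoly \<nu> f"
  shows "trigpoly \<nu> (\<lambda>s. cnj (f s))"
proof -
  obtain A where A: "degree A \<le> 2 * \<nu>" "\<And>s. cis s ^ \<nu> * f s = poly A (cis s)"
    using assms unfolding trigpoly_def by blast
  define B where "B = (\<Sum>i\<le>2 * \<nu>. monom (cnj (coeff A i)) (2 * \<nu> - i))"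
  have "degree B \<le> 2 * \<nu>"
    unfolding B_def by (intro degree_sum_le order_trans[OF degree_monom_le]) auto
  moreover have "cis s ^ \<nu> * cnj (f s) = poly B (cis s)" for s
  proof -
    have unit: "cis s ^ i * cnj (cis s) ^ i = 1" for i
      by (simp add: cis_cnj cis_mult flip: power_mult_distrib)
    have "poly A (cis s) = (\<Sum>i\<le>2 * \<nu>. coeff A i * cis s ^ i)"
      unfolding poly_altdef using A(1) by (intro sum.mono_neutral_left) (auto simp: coeff_eq_0)
    then have "cnj (cis s) ^ \<nu> * cnj (f s) = (\<Sum>i\<le>2 * \<nu>. cnj (coeff A i) * cnj (cis s) ^ i)"
      using arg_cong[OF A(2)[of s], of cnj] by simp
    then have "cis s ^ (2 * \<nu>) * (cnj (cis s) ^ \<nu> * cnj (f s))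
        = (\<Sum>i\<le>2 * \<nu>. cis s ^ (2 * \<nu>) * (cnj (coeff A i) * cnj (cis s) ^ i))"
      by (simp only: sum_distrib_left)
    also have "\<dots> = (\<Sum>i\<le>2 * \<nu>. cnj (coeff A i) * cis s ^ (2 * \<nu> - i))"
    proof (rule sum.cong)
      fix i assume "i \<in> {..2 * \<nu>}"
      then have "cis s ^ (2 * \<nu>) = cis s ^ (2 * \<nu> - i) * cis s ^ i" by (simp flip: power_add)
      then show "cis s ^ (2 * \<nu>) * (cnj (coeff A i) * cnj (cis s) ^ i) = cnj (coeff A i) * cis s ^ (2 * \<nu> - i)"
        using unit[of i] by (simp add: mult_ac)
    qed simp
    also have "\<dots> = poly B (cis s)" by (simp add: B_def poly_sum poly_monom)
    also have "cis s ^ (2 * \<nu>) * (cnj (cis s) ^ \<nu> * cnj (f s)) = cis s ^ \<nu> * (cis s ^ \<nu> * cnj (cis s) ^ \<nu>) * cnj (f s)"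
      unfolding mult_2 power_add by (simp only: mult_ac)
    finally show ?thesis by (simp only: unit mult_1_right)
  qed
  ultimately show ?thesis unfolding trigpoly_def by blast
qed

lemma trigpoly_Re:
  assumes "trigpoly \<nu> f"
  shows "trigpoly \<nu> (\<lambda>s. of_real (Re (f s)))"
proof -
  have "trigpoly (0 + \<nu>) (\<lambda>s. 1 / 2 * (f s + cnj (f s)))"
    by (intro trigpoly_mult trigpoly_const trigpoly_add trigpoly_cnj assms)
  also have "(\<lambda>s. 1 / 2 * (f s + cnj (f s))) = (\<lambda>s. of_real (Re (f s)))"
    by (simp add: fun_eq_iff complex_eq_iff)
  finally show ?thesis by simp
qed

lemma trigpoly_shift:
  assumes "trigpoly \<nu> f"
  shows "trigpoly \<nu> (\<lambda>s. f (s + c))"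
proof -
  obtain A where A: "degree A \<le> 2 * \<nu>" "\<And>s. cis s ^ \<nu> * f s = poly A (cis s)"
    using assms unfolding trigpoly_def by blast
  \<comment> \<open>The shift multiplies the variable by \<open>cis c\<close>; the factor
    \<open>cis (- c) ^ \<nu>\<close> undoes its effect on the clearing power.\<close>
  let ?B = "smult (cis (- c) ^ \<nu>) (pcompose A [:0, cis c:])"
  have "degree ?B \<le> 2 * \<nu>"
    using A(1) degree_pcompose_le[of A "[:0, cis c:]"] by (intro order_trans[OF degree_smult_le]) simp
  moreover have "cis s ^ \<nu> * f (s + c) = poly ?B (cis s)" for s
  proof -
    have "cis s = cis (- c) * cis (s + c)" by (simp add: cis_mult)
    then have "cis s ^ \<nu> * f (s + c) = cis (- c) ^ \<nu> * (cis (s + c) ^ \<nu> * f (s + c))"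
      by (metis power_mult_distrib mult.assoc)
    then show ?thesis unfolding A(2) by (simp add: poly_pcompose cis_mult)
  qed
  ultimately show ?thesis unfolding trigpoly_def by blast
qed

lemma trigpoly_poly:
  assumes "trigpoly k f"
  shows "trigpoly (degree p * k) (\<lambda>s. poly p (f s))"
proof (induction p)
  case 0
  show ?case by (simp add: trigpoly_const)
next
  case (pCons c p)
  show ?case
  proof (cases "p = 0")
    case True
    then show ?thesis by (simp add: trigpoly_const)
  next
    case False
    have "trigpoly (k + degree p * k) (\<lambda>s. c + f s * poly p (f s))"
      by (intro trigpoly_add trigpoly_const trigpoly_mult assms pCons.IH)
    then show ?thesis using False by simp
  qed
qed

text \<open>Euler's formulas. The two extreme coefficients are recorded because together they
  determine \<open>\<alpha> k\<close> and \<open>\<beta> k\<close>.\<close>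

lemma trig_sum_representation:
  assumes "k \<ge> 1"
  shows "\<exists>A. degree A \<le> 2 * k \<and> (\<forall>s. cis s ^ k * trig_sum \<alpha> \<beta> k s = poly A (cis s)) \<and>
    coeff A (2 * k) = (\<alpha> k - \<i> * \<beta> k) / 2 \<and> coeff A 0 = (\<alpha> k + \<i> * \<beta> k) / 2"
proof -
  define A where "A = monom (\<alpha> 0) k + (\<Sum>j=1..k. monom ((\<alpha> j - \<i> * \<beta> j) / 2) (k + j)
    + monom ((\<alpha> j + \<i> * \<beta> j) / 2) (k - j))"
  have "degree A \<le> 2 * k"
    unfolding A_def
    by (intro degree_add_le degree_sum_le order_trans[OF degree_monom_le]) auto
  moreover have "cis s ^ k * trig_sum \<alpha> \<beta> k s = poly A (cis s)" for s
  proof -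
    have "cis s ^ k * (\<alpha> j * of_real (cos (real j * s)) + \<beta> j * of_real (sin (real j * s)))
        = (\<alpha> j - \<i> * \<beta> j) / 2 * cis s ^ (k + j) + (\<alpha> j + \<i> * \<beta> j) / 2 * cis s ^ (k - j)"
      if "j \<in> {1..k}" for j
    proof -
      define w where "w = cis (real j * s)"
      have w: "cis s ^ j = w" by (simp add: w_def Complex.DeMoivre)
      have 1: "w * cnj w = 1" by (simp add: w_def cis_cnj cis_mult)
      have e: "cis s ^ k = cis s ^ (k - j) * w"
        using that by (simp flip: w power_add)
      have c: "complex_of_real (cos (real j * s)) = (w + cnj w) / 2"
        and d: "complex_of_real (sin (real j * s)) = - \<i> * (w - cnj w) / 2"
        by (simp_all add: w_def complex_eq_iff)
      have "w * (\<alpha> j * of_real (cos (real j * s)) + \<beta> j * of_real (sin (real j * s)))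
         = (\<alpha> j - \<i> * \<beta> j) / 2 * (w * w) + (\<alpha> j + \<i> * \<beta> j) / 2 * (w * cnj w)"
        unfolding c d by (simp add: field_simps)
      from arg_cong[OF this, of "(*) (cis s ^ (k - j))"] show ?thesis
        unfolding 1 power_add w e by (simp add: ring_distribs mult_ac)
    qed
    then show ?thesis
      unfolding trig_sum_def A_def by (simp add: poly_sum poly_monom distrib_left sum_distrib_left mult.commute)
  qed
  moreover have "coeff A (2 * k) = (\<alpha> k - \<i> * \<beta> k) / 2"
  proof -
    have "(\<Sum>j=1..k. (if k + j = 2 * k then (\<alpha> j - \<i> * \<beta> j) / 2 else 0) + (if k - j = 2 * k then (\<alpha> j + \<i> * \<beta> j) / 2 else 0))
      = (\<Sum>j=1..k. if j = k then (\<alpha> j - \<i> * \<beta> j) / 2 else 0)"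
      by (rule sum.cong) auto
    then show ?thesis using assms by (simp add: A_def coeff_sum)
  qed
  moreover have "coeff A 0 = (\<alpha> k + \<i> * \<beta> k) / 2"
  proof -
    have "(\<Sum>j=1..k. (if k + j = 0 then (\<alpha> j - \<i> * \<beta> j) / 2 else 0) + (if k - j = 0 then (\<alpha> j + \<i> * \<beta> j) / 2 else 0))
      = (\<Sum>j=1..k. if j = k then (\<alpha> j + \<i> * \<beta> j) / 2 else 0)"
      by (rule sum.cong) auto
    then show ?thesis using assms by (simp add: A_def coeff_sum)
  qed
  ultimately show ?thesis by blast
qed

lemma trigpoly_trig_sum: "k \<ge> 1 \<Longrightarrow> trigpoly k (trig_sum \<alpha> \<beta> k)"
  unfolding trigpoly_def using trig_sum_representation[of k \<alpha> \<beta>] by blast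

lemma cis_inj:
  assumes "cis x = cis y" "\<bar>x - y\<bar> < 2 * pi"
  shows "x = y"
proof -
  have "cis (x - y) = 1" using assms(1) by (simp flip: cis_divide)
  then have "cos (x - y) = 1" by (simp add: complex_eq_iff)
  then obtain i :: int where i: "x - y = of_int i * 2 * pi" using cos_one_2pi_int by blast
  then have "\<bar>of_int i * (2 * pi)\<bar> < 1 * (2 * pi)" using assms(2) by (simp add: mult.assoc)
  then have "\<bar>real_of_int i\<bar> < 1" unfolding abs_mult by simp
  then have "i = 0" by linarith
  then show "x = y" using i by simp
qed

text \<open>For a constant value \<open>c\<close>, the polynomial \<open>A - monom c k\<close>
  vanishes on an arc and hence identically. As \<open>k \<ge> 1\<close>, the exponents 0 and
  \<open>2 * k\<close> differ from \<open>k\<close>, so both extreme coefficients of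
  \<open>A\<close> vanish.\<close>

lemma trig_sum_not_constant_on:
  assumes k: "k \<ge> 1" and ab: "a < b" and const: "\<And>t. t \<in> {a..b} \<Longrightarrow> trig_sum \<alpha> \<beta> k t = c"
  shows "\<alpha> k = 0 \<and> \<beta> k = 0"
proof -
  obtain A where A: "\<And>s. cis s ^ k * trig_sum \<alpha> \<beta> k s = poly A (cis s)"
    "coeff A (2 * k) = (\<alpha> k - \<i> * \<beta> k) / 2" "coeff A 0 = (\<alpha> k + \<i> * \<beta> k) / 2"
    using trig_sum_representation[OF k] by blast
  \<comment> \<open>The interval is cut to length at most 1 to make \<open>cis\<close> injective on
    it.\<close>
  let ?B = "A - monom c k" and ?I = "{a..min b (a + 1)}"
  have "inj_on cis ?I"
    using pi_gt3 by (intro inj_onI cis_inj) auto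
  moreover have "infinite ?I" using ab by simp
  ultimately have "infinite (cis ` ?I)" by (simp add: finite_image_iff)
  moreover have "cis ` ?I \<subseteq> {w. poly ?B w = 0}"
    using const by (auto simp: poly_monom mult.commute simp flip: A(1))
  ultimately have "?B = 0" using poly_roots_finite infinite_super by metis
  then have "coeff ?B (2 * k) = 0" "coeff ?B 0 = 0" by (simp_all only: coeff_0)
  then have "\<alpha> k - \<i> * \<beta> k = 0" "\<alpha> k + \<i> * \<beta> k = 0" using k A(2,3) by auto
  then have "2 * \<alpha> k = 0" "2 * \<i> * \<beta> k = 0" by algebra+
  then show ?thesis by simp
qed

lemma trigpoly_continuous:
  assumes "trigpoly \<nu> f"
  shows "continuous_on S f"
proof -
  obtain A where A: "\<And>s. cis s ^ \<nu> * f s = poly A (cis s)"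
    using assms unfolding trigpoly_def by blast
  have "f s = poly A (cis s) / cis s ^ \<nu>" for s
    by (simp flip: A)
  then have "f = (\<lambda>s. poly A (cis s) / cis s ^ \<nu>)" by blast
  then show ?thesis by (simp add: continuous_intros)
qed

section \<open>Curves\<close>

lemma subperiodic_scale_bounds:
  assumes "a < b" "b - a \<le> 2 * pi"
  shows "0 < sin ((b - a) / 4)" "sin ((b - a) / 4) \<le> 1"
  using assms by (auto intro: sin_gt_zero)

lemma mult_scale_bounds:
  fixes u c :: real
  assumes "0 < c" "c \<le> 1"
  shows "u \<in> {-1..1} \<Longrightarrow> u * c \<in> {-1..1}" "u \<in> {-1<..<1} \<Longrightarrow> u * c \<in> {-1<..<1}"
proof -
  assume "u \<in> {-1..1}"
  then have "\<bar>u\<bar> * c \<le> 1 * 1" using assms by (intro mult_mono) auto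
  then have "\<bar>u * c\<bar> \<le> 1" using assms by (simp add: abs_mult)
  then show "u * c \<in> {-1..1}" by auto
next
  assume "u \<in> {-1<..<1}"
  then have "\<bar>u\<bar> * c < 1 * 1" using assms by (intro mult_less_le_imp_less) auto
  then have "\<bar>u * c\<bar> < 1" using assms by (simp add: abs_mult)
  then show "u * c \<in> {-1<..<1}" by auto
qed

text \<open>With \<open>s = 2 * arcsin (u * c)\<close> one has
  \<open>cos s = 1 - 2 * (u * c)\<^sup>2\<close>, so
  \<open>cos (2 * arccos u) = 2 * u\<^sup>2 - 1\<close> is a trigonometric polynomial of degree 1 in
  \<open>s\<close>. Hence degree \<nu> in \<open>s\<close> carries the comparison cosine of
  frequency \<open>2 * \<nu>\<close>, which is why twice as many nodes occur.\<close>

lemma trigonometric_norming: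
  assumes g: "trigpoly \<nu> g" and \<nu>: "\<nu> \<ge> 1" "2 * \<nu> < N"
    and ab: "a < b" "b - a \<le> 2 * pi" and u: "u \<in> {-1..1}"
  shows "\<exists>v\<in>chebyshev_points \<kappa> N.
    norm (g (node_map Trigonometric a b u)) * cos (real (2 * \<nu>) * pi / (2 * real N))
      \<le> norm (g (node_map Trigonometric a b v))"
proof -
  define c where "c = sin ((b - a) / 4)"
  have c: "0 < c" "c \<le> 1" using subperiodic_scale_bounds[OF ab] by (auto simp: c_def)
  define y where "y = (\<lambda>u. cis (2 * arcsin (u * c)))"
  have repr: "represented_by (2 * \<nu>) y (monom 1 \<nu>) (\<lambda>u. f (2 * arcsin (u * c)))"
    if "trigpoly \<nu> f" for f
    using that unfolding trigpoly_def represented_by_def y_def poly_monom by auto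
  show ?thesis
  proof (rule represented_norming[where y = y and E = "monom 1 \<nu>", OF _ \<nu>(2) _ _ _ _ _ _ u])
    show "inj_on y {-1<..<1}"
    proof (rule inj_onI)
      fix u v assume uv: "u \<in> {-1<..<1}" "v \<in> {-1<..<1}" "y u = y v"
      have *: "u * c \<in> {-1<..<1}" "v * c \<in> {-1<..<1}" using mult_scale_bounds(2)[OF c] uv by auto
      then have "\<bar>2 * arcsin (u * c) - 2 * arcsin (v * c)\<bar> < 2 * pi"
        using arcsin_lt_bounded[of "u * c"] arcsin_lt_bounded[of "v * c"] by auto
      then have "arcsin (u * c) = arcsin (v * c)"
        using uv(3) cis_inj unfolding y_def by fastforce
      then have "sin (arcsin (u * c)) = sin (arcsin (v * c))" by simp
      then have "u * c = v * c"
        using * by (subst (asm) (1 2) sin_arcsin) auto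
      then show "u = v" using c by simp
    qed
    show "represented_by (2 * \<nu>) y (monom 1 \<nu>) (\<lambda>u. of_real (Re (e * g (node_map Trigonometric a b u))))" for e
    proof -
      have "trigpoly (0 + \<nu>) (\<lambda>s. e * g (s + (b + a) / 2))"
        by (intro trigpoly_mult trigpoly_const trigpoly_shift g)
      then have "trigpoly \<nu> (\<lambda>s. of_real (Re (e * g (s + (b + a) / 2))))"
        by (intro trigpoly_Re) simp
      from repr[OF this] show ?thesis by (simp add: c_def)
    qed
    show "represented_by (2 * \<nu>) y (monom 1 \<nu>) (\<lambda>u. of_real (cos (real (2 * \<nu>) * arccos u)))"
    proof -
      obtain T :: "complex poly" where T: "degree T \<le> \<nu>"
        "\<And>\<theta>. poly T (of_real (cos \<theta>)) = of_real (cos (real \<nu> * \<theta>))"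
        using chebyshev_polynomial_exists[of \<nu>] by blast
      have "trigpoly 1 cis"
        unfolding trigpoly_def
        by (rule exI[of _ "monom 1 2"]) (simp add: poly_monom power2_eq_square degree_monom_eq)
      then have "trigpoly (0 + 1) (\<lambda>s. of_real (- 1 / c\<^sup>2) * cis s)"
        by (rule trigpoly_mult[OF trigpoly_const])
      \<comment> \<open>An affine function of \<open>cis s\<close> whose real part is
        \<open>(1 - cos s) / c\<^sup>2 - 1\<close>.\<close>
      then have "trigpoly 1 (\<lambda>s. of_real (1 / c\<^sup>2 - 1) + of_real (- 1 / c\<^sup>2) * cis s)"
        by (intro trigpoly_add[OF trigpoly_const]) simp
      then have "trigpoly 1 (\<lambda>s. of_real ((1 - cos s) / c\<^sup>2 - 1))"
        using trigpoly_Re by (fastforce simp: diff_divide_distrib algebra_simps)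
      from trigpoly_mono[OF trigpoly_poly[OF this, of T], of \<nu>]
      have "trigpoly \<nu> (\<lambda>s. poly T (of_real ((1 - cos s) / c\<^sup>2 - 1)))"
        using T(1) by simp
      note R = repr[OF this]
      have "poly T (of_real ((1 - cos (2 * arcsin (u * c))) / c\<^sup>2 - 1)) = of_real (cos (real (2 * \<nu>) * arccos u))"
        if "u \<in> {-1..1}" for u
      proof -
        have "u * c \<in> {-1..1}" using mult_scale_bounds(1)[OF c that] .
        then have "cos (2 * arcsin (u * c)) = 1 - 2 * (u * c)\<^sup>2"
          by (simp add: cos_double_sin)
        then have "(1 - cos (2 * arcsin (u * c))) / c\<^sup>2 - 1 = 2 * u\<^sup>2 - 1"
          using c by (simp add: power_mult_distrib)
        also have "\<dots> = cos (2 * arccos u)"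
          using that by (simp add: cos_double_cos cos_arccos)
        finally show ?thesis by (simp add: T(2) mult_ac)
      qed
      with R show ?thesis unfolding represented_by_def by auto
    qed
    have "continuous_on {-1..1} (\<lambda>u. node_map Trigonometric a b u)"
      using mult_scale_bounds(1)[OF c] by (auto simp flip: c_def intro!: continuous_intros)
    then show "continuous_on {-1..1} (\<lambda>u. g (node_map Trigonometric a b u))"
      by (rule continuous_on_compose2[OF trigpoly_continuous[OF g, of UNIV]]) simp
  qed (use \<nu> in \<open>auto simp: poly_monom y_def degree_monom_eq\<close>)
qed

lemma node_map_image:
  assumes "a < b" and "\<tau> = Trigonometric \<Longrightarrow> b - a \<le> 2 * pi"
  shows "node_map \<tau> a b ` {-1..1} = {a..b}"
proof (cases \<tau>)
  case Algebraic
  have "t \<in> node_map Algebraic a b ` {-1..1}" if "t \<in> {a..b}" for t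
    by (rule image_eqI[of _ _ "(2 * t - (b + a)) / (b - a)"]) (use that assms in \<open>auto simp: field_simps\<close>)
  moreover have "node_map Algebraic a b u \<in> {a..b}" if "u \<in> {-1..1}" for u
  proof -
    have "\<bar>(b - a) / 2 * u\<bar> \<le> (b - a) / 2 * 1"
      unfolding abs_mult using that assms by (intro mult_mono) auto
    then show ?thesis by (auto simp: abs_le_iff field_simps)
  qed
  ultimately show ?thesis unfolding Algebraic by blast
next
  case Trigonometric
  define \<omega> where "\<omega> = (b - a) / 4"
  \<comment> \<open>The bound \<open>b - a \<le> 2 * pi\<close> places \<omega> in the range where
    sine is increasing and \<open>arcsin\<close> inverts it.\<close>
  have \<omega>: "0 < \<omega>" "\<omega> \<le> pi / 2" using assms Trigonometric by (auto simp: \<omega>_def)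
  have c: "0 < sin \<omega>" "sin \<omega> \<le> 1"
    using subperiodic_scale_bounds assms Trigonometric by (auto simp: \<omega>_def)
  have arcsin_\<omega>: "arcsin (sin \<omega>) = \<omega>" using \<omega> by (intro arcsin_sin) auto
  have "t \<in> node_map Trigonometric a b ` {-1..1}" if t: "t \<in> {a..b}" for t
  proof -
    define s where "s = (t - (b + a) / 2) / 2"
    have s: "- \<omega> \<le> s" "s \<le> \<omega>" using t by (auto simp: s_def \<omega>_def field_simps)
    have "sin s \<le> sin \<omega>" "sin (- \<omega>) \<le> sin s"
      using s \<omega> by (intro sin_monotone_2pi_le; simp)+
    then have "sin s / sin \<omega> \<in> {-1..1}" using c by (auto simp: field_simps)
    moreover have "node_map Trigonometric a b (sin s / sin \<omega>) = t"
    proof -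
      have "arcsin (sin s) = s" using s \<omega> by (intro arcsin_sin) auto
      then show ?thesis using c by (simp flip: \<omega>_def) (simp add: s_def field_simps)
    qed
    ultimately show ?thesis by (metis imageI)
  qed
  moreover have "node_map Trigonometric a b u \<in> {a..b}" if u: "u \<in> {-1..1}" for u
  proof -
    have "u * sin \<omega> \<in> {-1..1}" using mult_scale_bounds(1)[OF c u] .
    then have "- 1 \<le> u * sin \<omega>" "u * sin \<omega> \<le> 1" by auto
    moreover have "u * sin \<omega> \<le> sin \<omega>" "- sin \<omega> \<le> u * sin \<omega>"
      using u c mult_right_mono[of u 1 "sin \<omega>"] mult_right_mono[of "-1" u "sin \<omega>"] by auto
    ultimately have "arcsin (u * sin \<omega>) \<le> arcsin (sin \<omega>)" "arcsin (- sin \<omega>) \<le> arcsin (u * sin \<omega>)"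
      using c by (intro arcsin_le_arcsin; linarith)+
    moreover have "arcsin (- sin \<omega>) = - \<omega>" using c arcsin_\<omega> by (simp add: arcsin_minus)
    ultimately have "- \<omega> \<le> arcsin (u * sin \<omega>)" "arcsin (u * sin \<omega>) \<le> \<omega>"
      unfolding arcsin_\<omega> by auto
    then show ?thesis by (simp flip: \<omega>_def) (simp add: \<omega>_def field_simps)
  qed
  ultimately show ?thesis unfolding Trigonometric by blast
qed

text \<open>Composing \<open>p\<close> with the curve gives degree at most \<open>n * k\<close>, and
  \<open>N\<close> is \<open>m\<close> times the comparison frequency in both cases, so the angle in
  the norming lemmas becomes \<open>pi / (2 * m)\<close>.\<close>

lemma curve_norming:
  assumes ab: "a < b" "\<tau> = Trigonometric \<Longrightarrow> b - a \<le> 2 * pi" and k: "k \<ge> 1"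
    and z: "poly_curve \<tau> k a b z"
    and n: "n \<ge> 1" "degree p \<le> n" and m: "m > 1" and N: "real N = node_number \<tau> m (n * k)"
    and t: "t \<in> {a..b}"
  shows "\<exists>v\<in>chebyshev_points \<kappa> N.
    norm (poly p (z t)) * cos (pi / (2 * m)) \<le> norm (poly p (z (node_map \<tau> a b v)))"
proof -
  obtain u where u: "u \<in> {-1..1}" "t = node_map \<tau> a b u"
    using t node_map_image[OF ab] by blast
  \<comment> \<open>The formula for \<open>z\<close> is available on \<open>[a,b]\<close> only, so
    every node has to be located there before it is used.\<close>
  have sub: "node_map \<tau> a b v \<in> {a..b}" if "v \<in> chebyshev_points \<kappa> N" for v
    using that node_map_image[OF ab] chebyshev_points_subset by blast
  have nk: "n * k \<ge> 1" using n k by simp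
  have "real (n * k) * 1 < real (n * k) * m" using nk m by (intro mult_strict_left_mono) auto
  then have mn: "real (n * k) < m * real (n * k)" by (simp only: mult_1_right mult.commute)
  show ?thesis
  proof (cases \<tau>)
    case Algebraic
    obtain q where q: "degree q = k" "\<And>t. t \<in> {a..b} \<Longrightarrow> z t = poly q (of_real t)"
      using z unfolding Algebraic by auto
    define Q where "Q = pcompose (pcompose p q) [:of_real ((b + a) / 2), of_real ((b - a) / 2):]"
    have "degree Q \<le> degree p * k * 1"
      unfolding Q_def q(1)[symmetric] degree_pcompose by (intro mult_le_mono) auto
    also have "\<dots> \<le> n * k" using n by simp
    finally have deg: "degree Q \<le> n * k" .
    have Q: "poly p (z (node_map \<tau> a b v)) = poly Q (of_real v)" if "node_map \<tau> a b v \<in> {a..b}" for v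
      unfolding q(2)[OF that] unfolding Q_def Algebraic by (simp add: poly_pcompose algebra_simps)
    have "real (n * k) < real N" unfolding N Algebraic using mn by simp
    then have "n * k < N" by (simp only: of_nat_less_iff)
    from algebraic_norming[OF deg nk this u(1), of \<kappa>]
    obtain v where v: "v \<in> chebyshev_points \<kappa> N"
      "norm (poly Q (of_real u)) * cos (real (n * k) * pi / (2 * real N)) \<le> norm (poly Q (of_real v))"
      by blast
    moreover have "real (n * k) * pi / (2 * real N) = pi / (2 * m)"
      unfolding N Algebraic using nk m by (simp add: field_simps)
    ultimately show ?thesis
      using Q[of u] Q[OF sub[OF v(1)]] t u(2) by (metis)
  next
    case Trigonometric
    obtain \<alpha> \<beta> where ts: "\<And>t. t \<in> {a..b} \<Longrightarrow> z t = trig_sum \<alpha> \<beta> k t"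
      using z unfolding Trigonometric by auto
    define g where "g = (\<lambda>s. poly p (trig_sum \<alpha> \<beta> k s))"
    have g: "trigpoly (n * k) g"
      unfolding g_def
      by (rule trigpoly_mono[OF trigpoly_poly[OF trigpoly_trig_sum[OF k]]]) (use n in simp)
    have "real (2 * (n * k)) < real N" unfolding N Trigonometric using mn by simp
    then have "2 * (n * k) < N" by (simp only: of_nat_less_iff)
    from trigonometric_norming[OF g nk this ab(1) ab(2)[OF Trigonometric] u(1), of \<kappa>]
    obtain v where v: "v \<in> chebyshev_points \<kappa> N"
      "norm (g (node_map Trigonometric a b u)) * cos (real (2 * (n * k)) * pi / (2 * real N))
        \<le> norm (g (node_map Trigonometric a b v))"
      by blast
    moreover have "real (2 * (n * k)) * pi / (2 * real N) = pi / (2 * m)"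
      unfolding N Trigonometric using nk m by (simp add: field_simps)
    moreover have "poly p (z s) = g s" if "s \<in> {a..b}" for s
      using ts[OF that] by (simp add: g_def)
    ultimately show ?thesis
      using sub[OF v(1)] t u(2) unfolding Trigonometric by metis
  qed
qed

section \<open>The norm inequality between the curve and the mesh\<close>

lemma node_number_nat:
  assumes "node_number \<tau> m \<nu> \<in> \<nat>"
  shows "real (nat \<lfloor>node_number \<tau> m \<nu>\<rfloor>) = node_number \<tau> m \<nu>"
  using assms by (auto simp: Nats_def)

lemma mapped_points_nonempty:
  assumes "node_number \<tau> m \<nu> \<in> \<nat>" "m > 1" "\<nu> \<ge> 1"
  shows "mapped_points \<tau> \<kappa> a b m \<nu> \<noteq> {}"
proof -
  have "node_number \<tau> m \<nu> > 0" using assms(2,3) by (cases \<tau>) auto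
  then have "nat \<lfloor>node_number \<tau> m \<nu>\<rfloor> \<ge> 1" using node_number_nat[OF assms(1)] by linarith
  then show ?thesis unfolding mapped_points_def using chebyshev_points_nonempty by blast
qed

lemma mesh_inequality:
  assumes ab: "a < b" "\<tau> = Trigonometric \<Longrightarrow> b - a \<le> 2 * pi" and k: "k \<ge> 1"
    and z: "poly_curve \<tau> k a b z"
    and n: "n \<ge> 1" "degree p \<le> n" and m: "m > 1" and N: "node_number \<tau> m (n * k) \<in> \<nat>"
  shows "sup_norm (z ` {a..b}) (poly p)
    \<le> 1 / cos (pi / (2 * m)) * sup_norm (z ` mapped_points \<tau> \<kappa> a b m (n * k)) (poly p)"
proof -
  let ?Z = "z ` mapped_points \<tau> \<kappa> a b m (n * k)"
  have "pi / (2 * m) < pi / 2" using m by (simp add: field_simps)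
  then have c: "0 < cos (pi / (2 * m))"
    using m by (intro cos_gt_zero_pi) (auto intro: less_trans[of _ 0])
  \<comment> \<open>The supremum over the mesh dominates its members only if it is bounded;
    finiteness ensures this.\<close>
  have fin: "bdd_above ((\<lambda>x. norm (poly p x)) ` ?Z)"
    unfolding mapped_points_def by (intro bdd_above_finite finite_imageI finite_chebyshev_points)
  have "norm (poly p (z t)) \<le> 1 / cos (pi / (2 * m)) * sup_norm ?Z (poly p)" if t: "t \<in> {a..b}" for t
  proof -
    obtain v where v: "v \<in> chebyshev_points \<kappa> (nat \<lfloor>node_number \<tau> m (n * k)\<rfloor>)"
      "norm (poly p (z t)) * cos (pi / (2 * m)) \<le> norm (poly p (z (node_map \<tau> a b v)))"
      using curve_norming[OF ab k z n m node_number_nat[OF N] t] by blast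
    note v(2)
    also have "norm (poly p (z (node_map \<tau> a b v))) \<le> sup_norm ?Z (poly p)"
      unfolding sup_norm_def by (rule cSUP_upper[OF _ fin]) (use v(1) in \<open>simp add: mapped_points_def\<close>)
    finally show ?thesis using c by (simp add: field_simps)
  qed
  then show ?thesis
    unfolding sup_norm_def[of "z ` {a..b}"] using ab by (intro cSUP_least) auto
qed

section \<open>Topology of the curve and polynomial determination\<close>

lemma poly_curve_continuous:
  assumes "poly_curve \<tau> k a b z"
  shows "continuous_on {a..b} z"
proof (cases \<tau>)
  case Algebraic
  then obtain q where "\<And>t. t \<in> {a..b} \<Longrightarrow> z t = poly q (of_real t)" using assms by auto
  moreover have "continuous_on {a..b} (\<lambda>t. poly q (complex_of_real t))" by (intro continuous_intros)
  ultimately show ?thesis by (metis continuous_on_eq)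
next
  case Trigonometric
  then obtain \<alpha> \<beta> where "\<And>t. t \<in> {a..b} \<Longrightarrow> z t = trig_sum \<alpha> \<beta> k t" using assms by auto
  moreover have "continuous_on {a..b} (trig_sum \<alpha> \<beta> k)"
    unfolding trig_sum_def by (intro continuous_intros)
  ultimately show ?thesis by (metis continuous_on_eq)
qed

lemma poly_curve_not_constant:
  assumes "a < b" "k \<ge> 1" "poly_curve \<tau> k a b z"
  shows "\<not> (\<forall>t\<in>{a..b}. z t = c)"
proof
  assume c: "\<forall>t\<in>{a..b}. z t = c"
  show False
  proof (cases \<tau>)
    case Algebraic
    then obtain q where q: "degree q = k" "\<And>t. t \<in> {a..b} \<Longrightarrow> z t = poly q (of_real t)"
      using assms by auto
    have "infinite (complex_of_real ` {a..b})"
      using assms(1) by (simp add: finite_image_iff inj_on_def)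
    moreover have "complex_of_real ` {a..b} \<subseteq> {w. poly (q - [:c:]) w = 0}"
      using c q(2) by auto
    ultimately have "q - [:c:] = 0" using poly_roots_finite infinite_super by metis
    then show False using q(1) assms(2) by simp
  next
    case Trigonometric
    then obtain \<alpha> \<beta> where ts: "\<alpha> k \<noteq> 0 \<or> \<beta> k \<noteq> 0" "\<And>t. t \<in> {a..b} \<Longrightarrow> z t = trig_sum \<alpha> \<beta> k t"
      using assms(3) unfolding Trigonometric poly_curve.simps by blast
    then have "\<alpha> k = 0 \<and> \<beta> k = 0"
      using c by (intro trig_sum_not_constant_on[OF assms(2,1), of _ _ c]) auto
    with ts(1) show False by simp
  qed
qed

text \<open>The image is connected, and a finite connected set has at most one point, which a
  nonconstant curve rules out.\<close>

lemma infinite_poly_curve_image: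
  assumes "a < b" "k \<ge> 1" "poly_curve \<tau> k a b z"
  shows "infinite (z ` {a..b})"
proof
  assume "finite (z ` {a..b})"
  moreover have "connected (z ` {a..b})"
    by (intro connected_continuous_image poly_curve_continuous[OF assms(3)]) auto
  ultimately have "z ` {a..b} = {} \<or> (\<exists>c. z ` {a..b} = {c})"
    by (simp only: connected_finite_iff_sing)
  then obtain c where "z ` {a..b} = {c}" using assms(1) by auto
  then have "\<forall>t\<in>{a..b}. z t = c" by blast
  then show False using poly_curve_not_constant[OF assms] by blast
qed

lemma infinite_polynomially_determining:
  assumes "infinite K"
  shows "polynomially_determining K"
  unfolding polynomially_determining_def
proof (intro allI impI)
  fix p :: "complex poly" and x assume "\<forall>x\<in>K. poly p x = 0"
  then have "K \<subseteq> {x. poly p x = 0}" by blast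
  then have "p = 0" using poly_roots_finite assms finite_subset by blast
  then show "poly p x = 0" by simp
qed

theorem proposition1:
  fixes a b :: real and k :: nat and z :: "real \<Rightarrow> complex"
    and \<tau> :: curve_type and \<kappa> :: chebyshev_kind
  assumes "a < b" and "k \<ge> 1"
    and "poly_curve \<tau> k a b z"
    and "\<tau> = Trigonometric \<Longrightarrow> b - a \<le> 2 * pi"
  shows "(\<forall>n\<ge>1. \<forall>m>1. node_number \<tau> m (n * k) \<in> \<nat> \<longrightarrow>
            (\<forall>p :: complex poly. degree p \<le> n \<longrightarrow>
               sup_norm (z ` {a..b}) (poly p)
                 \<le> 1 / cos (pi / (2 * m)) * sup_norm (z ` mapped_points \<tau> \<kappa> a b m (n * k)) (poly p)))
       \<and> (\<forall>m>1. (\<forall>n\<ge>1. node_number \<tau> m (n * k) \<in> \<nat>) \<longrightarrow>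
            optimal_admissible_mesh (z ` {a..b}) (\<lambda>n. z ` mapped_points \<tau> \<kappa> a b m (n * k)))"
proof (intro conjI allI impI)
  fix n m and p :: "complex poly" assume "n \<ge> 1" "m > 1" "node_number \<tau> m (n * k) \<in> \<nat>" "degree p \<le> n"
  then show "sup_norm (z ` {a..b}) (poly p)
      \<le> 1 / cos (pi / (2 * m)) * sup_norm (z ` mapped_points \<tau> \<kappa> a b m (n * k)) (poly p)"
    using assms by (intro mesh_inequality) auto
next
  fix m :: real assume m: "m > 1" and nat: "\<forall>n\<ge>1. node_number \<tau> m (n * k) \<in> \<nat>"
  let ?Z = "\<lambda>n. z ` mapped_points \<tau> \<kappa> a b m (n * k)"
  \<comment> \<open>The mesh has at most \<open>N + 1\<close> points with
    \<open>N \<le> 2 * m * real (n * k)\<close> for both curve types; the extra point is absorbed by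
    \<open>1 \<le> n\<close>.\<close>
  have card: "real (card (?Z n)) \<le> (2 * m * real k + 1) * real n" if n: "n \<ge> 1" for n
  proof -
    have "card (?Z n) \<le> card (chebyshev_points \<kappa> (nat \<lfloor>node_number \<tau> m (n * k)\<rfloor>))"
      unfolding mapped_points_def image_image by (intro card_image_le finite_chebyshev_points)
    also have "\<dots> \<le> nat \<lfloor>node_number \<tau> m (n * k)\<rfloor> + 1" by (rule card_chebyshev_points_le)
    finally have "real (card (?Z n)) \<le> node_number \<tau> m (n * k) + 1"
      using node_number_nat[of \<tau> m "n * k"] nat n by simp
    also have "node_number \<tau> m (n * k) \<le> 2 * m * real (n * k)" using m by (cases \<tau>) auto
    finally show ?thesis using n by (simp add: algebra_simps)
  qed
  then have O1: "(\<lambda>n. real (card (?Z n))) \<in> O(\<lambda>n. real n)"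
    by (intro bigoI[of _ "2 * m * real k + 1"] eventually_mono[OF eventually_ge_at_top[of 1]]) auto
  then have "(\<lambda>n. real (card (?Z n))) \<in> O(\<lambda>n. real n powr 1)" by simp
  moreover have "compact (z ` {a..b})"
    by (intro compact_continuous_image poly_curve_continuous[OF assms(3)]) auto
  moreover have "polynomially_determining (z ` {a..b})"
    using infinite_poly_curve_image[OF assms(1-3)] by (rule infinite_polynomially_determining)
  moreover have "finite (?Z n)" for n
    unfolding mapped_points_def by (intro finite_imageI finite_chebyshev_points)
  moreover have "?Z n \<noteq> {}" if "n \<ge> 1" for n
    using mapped_points_nonempty[of \<tau> m "n * k"] nat m that assms(2) by auto
  moreover have "?Z n \<subseteq> z ` {a..b}" for n
    unfolding mapped_points_def
    using chebyshev_points_subset node_map_image[OF assms(1,4)] by (intro image_mono) blast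
  moreover have "\<exists>c. \<forall>n\<ge>1. \<forall>p :: complex poly. degree p \<le> n \<longrightarrow>
      sup_norm (z ` {a..b}) (poly p) \<le> c * sup_norm (?Z n) (poly p)"
    using mesh_inequality[OF assms(1,4,2,3)] nat m by blast
  ultimately show "optimal_admissible_mesh (z ` {a..b}) ?Z"
    unfolding optimal_admissible_mesh_def admissible_mesh_def using O1 by blast
qed

end
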